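(* Let $\{ p_{n+1,n} : (I_{n+1},\phi_{n+1}) \to (I_n,\phi_n) : n\in\mathbb{N} \}$ be a pointed Shimomura sequence with inverse limit $(X,f)$. The sequence has the factoring property if and only if $f$ has the lifting property with respect to the sequence.
   Context: $\mathbb{N}$ is the set of positive integers; $\mathcal{I}$ is the set of all nonempty finite subsets of $\mathbb{N}^n$, $n=1,2,\dots$ (discrete). A system $(A,R)$ is a compact metric space $A$ with a closed relation $R\subset A\times A$ that is surjective (both projections onto $A$); maps are identified with their graphs. A system surjection $p:(A,R)\to(B,S)$ is a continuous surjection $p:A\to B$ with $(p\times p)(R)=S$. A Shimomura sequence is a sequence of system surjections $p_{n+1,n}:(I_{n+1},\phi_{n+1})\to(I_n,\phi_n)$, $n\in\mathbb{N}$, with all $I_n\in\mathcal{I}$, $\phi_n$ surjective relations, such that, with $p_{m,n}=p_{n+1,n}\circ\cdots\circ p_{m,m-1}$ for $m>n$: (bifurcation) for every $n$ and $x\in I_n$ there are $m>n$ and $y_1\ne y_2$ in $I_m$ with $p_{m,n}(y_1)=p_{m,n}(y_2)=x$; (Shimomura Condition) for every $n$ there is $m>n$ such that $p_{m,n}\circ\phi_m=\{(a,p_{m,n}(b)):(a,b)\in\phi_m\}$ is a map $I_m\to I_n$. It is pointed if $I_1$ is a singleton. Its inverse limit is the pair $X=\{z\in\prod_n I_n: z_n=p_{n+1,n}(z_{n+1})\ \forall n\}$, $f=\{(x,y)\in X\times X:(x_n,y_n)\in\phi_n\ \forall n\}$; here $X$ is a Cantor space (with a compatible metric $d$) and $f$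 is a continuous surjection $X\to X$. The mesh of a continuous map $\beta:X\to J$, $J$ finite, is $\max\{d(x,y):\beta(x)=\beta(y)\}$. Lifting property of $f$ with respect to the sequence: for every $\epsilon>0$, $n\in\mathbb{N}$ and every system surjection $\alpha:(X,f)\to(I_n,\phi_n)$ there exist $m>n$ and a system surjection $\beta:(X,f)\to(I_m,\phi_m)$ with $\alpha=p_{m,n}\circ\beta$ and mesh of $\beta$ less than $\epsilon$. Factoring property of the sequence: whenever $k>n$ and $q_1:(I_k,\phi_k)\to(I_n,\phi_n)$ is a system surjection, there exist $m>k$ and a system surjection $q_2:(I_m,\phi_m)\to(I_k,\phi_k)$ with $q_1\circ q_2=p_{m,n}$. *)

theory Defs
  imports "HOL-Analysis.Analysis"
begin

text \<open>The index set is the set of positive integers. Sequences are functions on \<^typ>\<open>nat\<close> whose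
  value at 0 is never used. A point of the \<open>k\<close>-fold power of the positive integers is a list of
  length \<open>k\<close> with positive entries.\<close>

definition finite_index_sets :: "nat list set set" where
  "finite_index_sets =
    {F. finite F \<and> F \<noteq> {} \<and> (\<exists>k\<ge>1. F \<subseteq> {x. length x = k \<and> (\<forall>i\<in>set x. 1 \<le> i)})}"

definition system :: "'a topology \<Rightarrow> ('a \<times> 'a) set \<Rightarrow> bool" where
  "system T R \<longleftrightarrow>
    compact_space T \<and> metrizable_space T \<and> closedin (prod_topology T T) R \<and>
    fst ` R = topspace T \<and> snd ` R = topspace T"

definition system_surjection ::
  "'a topology \<Rightarrow> ('a \<times> 'a) set \<Rightarrow> 'b topology \<Rightarrow> ('b \<times> 'b) set \<Rightarrow> ('a \<Rightarrow> 'b) \<Rightarrow> bool" where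
  "system_surjection T R U S p \<longleftrightarrow>
    system T R \<and> system U S \<and>
    continuous_map T U p \<and> p ` topspace T = topspace U \<and> map_prod p p ` R = S"

definition is_map :: "'a set \<Rightarrow> 'b set \<Rightarrow> ('a \<times> 'b) set \<Rightarrow> bool" where
  "is_map A B R \<longleftrightarrow> R \<subseteq> A \<times> B \<and> (\<forall>a\<in>A. \<exists>!b. (a, b) \<in> R)"

text \<open>\<open>p n\<close> is the bonding map from level \<open>n + 1\<close> to level \<open>n\<close>, and \<open>bond p m n\<close> is the composite
  \<open>p n \<circ> \<dots> \<circ> p (m - 1)\<close> from level \<open>m\<close> to level \<open>n\<close>, used only for \<open>m > n\<close>.\<close>

primrec bond :: "(nat \<Rightarrow> 'a \<Rightarrow> 'a) \<Rightarrow> nat \<Rightarrow> nat \<Rightarrow> 'a \<Rightarrow> 'a" where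
  "bond p 0 n = id"
| "bond p (Suc m) n = (if n \<le> m then bond p m n \<circ> p m else id)"

definition shimomura_sequence ::
  "(nat \<Rightarrow> nat list set) \<Rightarrow> (nat \<Rightarrow> (nat list \<times> nat list) set) \<Rightarrow>
   (nat \<Rightarrow> nat list \<Rightarrow> nat list) \<Rightarrow> bool" where
  "shimomura_sequence I \<phi> p \<longleftrightarrow>
    (\<forall>n\<ge>1. I n \<in> finite_index_sets) \<and>
    (\<forall>n\<ge>1. system_surjection (discrete_topology (I (n + 1))) (\<phi> (n + 1))
              (discrete_topology (I n)) (\<phi> n) (p n)) \<and>
    (\<forall>n\<ge>1. \<forall>x\<in>I n. \<exists>m>n. \<exists>y1\<in>I m. \<exists>y2\<in>I m.
       y1 \<noteq> y2 \<and> bond p m n y1 = x \<and> bond p m n y2 = x) \<and>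
    (\<forall>n\<ge>1. \<exists>m>n. is_map (I m) (I n) {(a, bond p m n b) | a b. (a, b) \<in> \<phi> m})"

definition pointed_shimomura_sequence ::
  "(nat \<Rightarrow> nat list set) \<Rightarrow> (nat \<Rightarrow> (nat list \<times> nat list) set) \<Rightarrow>
   (nat \<Rightarrow> nat list \<Rightarrow> nat list) \<Rightarrow> bool" where
  "pointed_shimomura_sequence I \<phi> p \<longleftrightarrow> shimomura_sequence I \<phi> p \<and> is_singleton (I 1)"

definition inverse_limit :: "(nat \<Rightarrow> 'a set) \<Rightarrow> (nat \<Rightarrow> 'a \<Rightarrow> 'a) \<Rightarrow> (nat \<Rightarrow> 'a) set" where
  "inverse_limit I p = {z \<in> (\<Pi>\<^sub>E n\<in>{1..}. I n). \<forall>n\<ge>1. z n = p n (z (n + 1))}"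

definition inverse_limit_topology ::
  "(nat \<Rightarrow> 'a set) \<Rightarrow> (nat \<Rightarrow> 'a \<Rightarrow> 'a) \<Rightarrow> (nat \<Rightarrow> 'a) topology" where
  "inverse_limit_topology I p =
    subtopology (product_topology (\<lambda>n. discrete_topology (I n)) {1..}) (inverse_limit I p)"

definition inverse_limit_relation ::
  "(nat \<Rightarrow> 'a set) \<Rightarrow> (nat \<Rightarrow> ('a \<times> 'a) set) \<Rightarrow> (nat \<Rightarrow> 'a \<Rightarrow> 'a) \<Rightarrow>
   ((nat \<Rightarrow> 'a) \<times> (nat \<Rightarrow> 'a)) set" where
  "inverse_limit_relation I \<phi> p =
    {(x, y) \<in> inverse_limit I p \<times> inverse_limit I p. \<forall>n\<ge>1. (x n, y n) \<in> \<phi> n}"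

definition compatible_metric :: "'a topology \<Rightarrow> ('a \<Rightarrow> 'a \<Rightarrow> real) \<Rightarrow> bool" where
  "compatible_metric T d \<longleftrightarrow>
    Metric_space (topspace T) d \<and> Metric_space.mtopology (topspace T) d = T"

text \<open>For a continuous map from a nonempty compact space to a finite discrete one the supremum
  below is attained, so it is a maximum; \<^const>\<open>Max\<close> is only meaningful for finite sets.\<close>

definition mesh :: "'a set \<Rightarrow> ('a \<Rightarrow> 'a \<Rightarrow> real) \<Rightarrow> ('a \<Rightarrow> 'b) \<Rightarrow> real" where
  "mesh X d \<beta> = Sup {d x y | x y. x \<in> X \<and> y \<in> X \<and> \<beta> x = \<beta> y}"

definition lifting_property ::
  "(nat \<Rightarrow> 'a set) \<Rightarrow> (nat \<Rightarrow> ('a \<times> 'a) set) \<Rightarrow> (nat \<Rightarrow> 'a \<Rightarrow> 'a) \<Rightarrow>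
   ((nat \<Rightarrow> 'a) \<Rightarrow> (nat \<Rightarrow> 'a) \<Rightarrow> real) \<Rightarrow> bool" where
  "lifting_property I \<phi> p d \<longleftrightarrow>
    (\<forall>\<epsilon>>0. \<forall>n\<ge>1. \<forall>\<alpha>.
       system_surjection (inverse_limit_topology I p) (inverse_limit_relation I \<phi> p)
         (discrete_topology (I n)) (\<phi> n) \<alpha> \<longrightarrow>
       (\<exists>m>n. \<exists>\<beta>.
          system_surjection (inverse_limit_topology I p) (inverse_limit_relation I \<phi> p)
            (discrete_topology (I m)) (\<phi> m) \<beta> \<and>
          (\<forall>x\<in>inverse_limit I p. \<alpha> x = bond p m n (\<beta> x)) \<and>
          mesh (inverse_limit I p) d \<beta> < \<epsilon>))"

definition factoring_property ::
  "(nat \<Rightarrow> 'a set) \<Rightarrow> (nat \<Rightarrow> ('a \<times> 'a) set) \<Rightarrow> (nat \<Rightarrow> 'a \<Rightarrow> 'a) \<Rightarrow> bool" where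
  "factoring_property I \<phi> p \<longleftrightarrow>
    (\<forall>n\<ge>1. \<forall>k>n. \<forall>q1.
       system_surjection (discrete_topology (I k)) (\<phi> k) (discrete_topology (I n)) (\<phi> n) q1 \<longrightarrow>
       (\<exists>m>k. \<exists>q2.
          system_surjection (discrete_topology (I m)) (\<phi> m) (discrete_topology (I k)) (\<phi> k) q2 \<and>
          (\<forall>x\<in>I m. q1 (q2 x) = bond p m n x)))"

end

theory Submission
  imports Defs
begin

text \<open>
  Write \<open>\<pi>\<^sub>k : X \<rightarrow> I\<^sub>k\<close> for the coordinate projections of the inverse limit. The proof rests on three
  facts about them. Each \<open>\<pi>\<^sub>k\<close> is a system surjection, because every edge of \<open>\<phi>\<^sub>k\<close> lifts level by
  level to an edge of \<open>f\<close> (lemmas \<open>edge_lifts\<close> and \<open>projection_surjection\<close>). The partitions of \<open>X\<close> into fibres of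
  \<open>\<pi>\<^sub>k\<close> refine every open cover once \<open>k\<close> is large, by compactness (lemma \<open>cylinders_refine_cover\<close>).
  And whenever one system surjection out of \<open>X\<close> is constant on the fibres of another one, the induced
  map between the finite targets is again a system surjection (lemma \<open>system_surjection_factors\<close>).

  Lifting implies factoring: given \<open>q\<^sub>1 : I\<^sub>k \<rightarrow> I\<^sub>n\<close>, lift \<open>\<alpha> = q\<^sub>1 \<circ> \<pi>\<^sub>k\<close> to \<open>\<beta> : X \<rightarrow> I\<^sub>j\<close> with
  \<open>p\<^bsub>j,n\<^esub> \<circ> \<beta> = \<alpha>\<close> and with mesh so small that \<open>\<pi>\<^sub>k = r \<circ> \<beta>\<close> for some \<open>r : I\<^sub>j \<rightarrow> I\<^sub>k\<close>. Then
  \<open>p\<^bsub>j,n\<^esub> \<circ> \<beta> = q\<^sub>1 \<circ> r \<circ> \<beta>\<close>, and \<open>\<beta>\<close> can be cancelled because it is onto; so \<open>r\<close>, precomposed with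
  a bonding map to get above level \<open>k\<close>, is the required \<open>q\<^sub>2\<close>.

  Factoring implies lifting: a system surjection \<open>\<alpha> : X \<rightarrow> I\<^sub>n\<close> has the form \<open>q \<circ> \<pi>\<^sub>k\<close> for some
  large \<open>k\<close>, which can also be chosen so that the fibres of \<open>\<pi>\<^sub>k\<close> have diameter below \<open>\<epsilon>\<close>. Apply the
  factoring property twice, first to \<open>q\<close> and then to the resulting \<open>q\<^sub>2\<close>:
  \<open>q \<circ> q\<^sub>2 = p\<^bsub>m,n\<^esub>\<close> and \<open>q\<^sub>2 \<circ> q\<^sub>3 = p\<^bsub>l,k\<^esub>\<close>. Put \<open>\<beta> = q\<^sub>3 \<circ> \<pi>\<^sub>l\<close>. Then
  \<open>q\<^sub>2 \<circ> \<beta> = p\<^bsub>l,k\<^esub> \<circ> \<pi>\<^sub>l = \<pi>\<^sub>k\<close>, so the mesh of \<open>\<beta>\<close> is at most that of \<open>\<pi>\<^sub>k\<close>, and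
  \<open>p\<^bsub>m,n\<^esub> \<circ> \<beta> = q \<circ> q\<^sub>2 \<circ> \<beta> = q \<circ> \<pi>\<^sub>k = \<alpha>\<close>.
\<close>

section \<open>System surjections\<close>

lemma system_surjection_compose:
  assumes "system_surjection T R U S p" and "system_surjection U S V Q q"
  shows "system_surjection T R V Q (q \<circ> p)"
proof -
  have "map_prod (q \<circ> p) (q \<circ> p) ` R = map_prod q q ` (map_prod p p ` R)"
    by (simp add: image_comp map_prod.comp)
  moreover have "(q \<circ> p) ` topspace T = q ` (p ` topspace T)"
    by (simp add: image_comp)
  ultimately show ?thesis
    using assms unfolding system_surjection_def by (auto intro: continuous_map_compose)
qed

lemma system_subset:
  assumes "system T R" shows "R \<subseteq> topspace T \<times> topspace T"
  using assms closedin_subset unfolding system_def by fastforce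

text \<open>Discreteness of the middle space makes the induced map continuous for free; it carries \<open>S\<close>
  onto \<open>Q\<close> because both are images of the same relation \<open>R\<close>.\<close>

lemma system_surjection_factors:
  assumes a: "system_surjection T R V Q a"
    and b: "system_surjection T R (discrete_topology B) S b"
    and fibres: "\<And>x y. x \<in> topspace T \<Longrightarrow> y \<in> topspace T \<Longrightarrow> b x = b y \<Longrightarrow> a x = a y"
  obtains q where "system_surjection (discrete_topology B) S V Q q"
    and "\<And>x. x \<in> topspace T \<Longrightarrow> a x = q (b x)"
proof -
  obtain q where q: "\<And>x. x \<in> topspace T \<Longrightarrow> a x = q (b x)"
    using function_factors_left_gen[of "\<lambda>x. x \<in> topspace T" b a] fibres by blast
  have B: "b ` topspace T = B" and S: "map_prod b b ` R = S"
    and V: "a ` topspace T = topspace V" and Q: "map_prod a a ` R = Q"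
    using a b unfolding system_surjection_def by auto
  have R: "R \<subseteq> topspace T \<times> topspace T"
    using a system_subset unfolding system_surjection_def by blast
  have qB: "q ` B = topspace V"
    unfolding V[symmetric] B[symmetric] image_image using q by (intro image_cong) auto
  have "map_prod q q ` S = Q"
    unfolding S[symmetric] Q[symmetric] image_image using q R by (intro image_cong) auto
  then have "system_surjection (discrete_topology B) S V Q q"
    using a b qB unfolding system_surjection_def by auto
  with q that show thesis by blast
qed

section \<open>Inverse limits of finite systems\<close>

lemma bond_self [simp]: "bond p n n = id"
  by (cases n) auto

lemma bond_bond:
  assumes "n \<le> j" "j \<le> m" shows "bond p j n (bond p m j x) = bond p m n x"
  using assms
proof (induction m arbitrary: x)
  case (Suc m)
  then show ?case by (cases "j = Suc m") auto
qed auto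

locale finite_system_sequence =
  fixes I :: "nat \<Rightarrow> 'a set" and \<phi> :: "nat \<Rightarrow> ('a \<times> 'a) set" and p :: "nat \<Rightarrow> 'a \<Rightarrow> 'a"
  assumes finite_level: "1 \<le> n \<Longrightarrow> finite (I n)"
    and bonding: "1 \<le> n \<Longrightarrow> system_surjection (discrete_topology (I (n + 1))) (\<phi> (n + 1))
          (discrete_topology (I n)) (\<phi> n) (p n)"
begin

abbreviation "X \<equiv> inverse_limit I p"
abbreviation "T \<equiv> inverse_limit_topology I p"
abbreviation "f \<equiv> inverse_limit_relation I \<phi> p"
abbreviation "level n \<equiv> discrete_topology (I n)"

lemma system_level: "1 \<le> n \<Longrightarrow> system (level n) (\<phi> n)"
  using bonding unfolding system_surjection_def by blast

lemma topspace_limit: "topspace T = X"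
  unfolding inverse_limit_topology_def inverse_limit_def by auto

text \<open>The thread condition is oriented downwards here: read from left to right, the equation in the
  definition of \<^const>\<open>inverse_limit\<close> would rewrite a coordinate to ever higher ones.\<close>

lemma in_limit_iff:
  "x \<in> X \<longleftrightarrow> x \<in> extensional {1..} \<and> (\<forall>n\<ge>1. x n \<in> I n) \<and> (\<forall>n\<ge>1. p n (x (n + 1)) = x n)"
proof -
  have flip: "x n = p n (x (n + 1)) \<longleftrightarrow> p n (x (n + 1)) = x n" for n
    by (rule eq_commute)
  show ?thesis
    unfolding inverse_limit_def PiE_iff mem_Collect_eq Ball_def atLeast_iff flip by blast
qed

lemma in_level: "x \<in> X \<Longrightarrow> 1 \<le> n \<Longrightarrow> x n \<in> I n"
  unfolding in_limit_iff by blast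

lemma bond_surjection:
  assumes "1 \<le> n" "n \<le> m"
  shows "system_surjection (level m) (\<phi> m) (level n) (\<phi> n) (bond p m n)"
  using assms(2)
proof (induction m rule: dec_induct)
  case base
  show ?case
    using system_level[OF assms(1)] by (auto simp: system_surjection_def map_prod.id)
next
  case (step m)
  have "1 \<le> m" using assms(1) step.hyps(1) by simp
  from system_surjection_compose[OF bonding[OF this] step.IH]
  show ?case using step.hyps(1) by (simp add: o_def)
qed

lemma bond_coordinate:
  assumes "x \<in> X" "1 \<le> n" "n \<le> m"
  shows "bond p m n (x m) = x n"
  using assms(3)
proof (induction m rule: dec_induct)
  case (step m)
  have "p m (x (Suc m)) = x m"
    using assms(1,2) step.hyps(1) unfolding in_limit_iff by simp
  then show ?case using step.IH step.hyps(1) by simp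
qed simp

lemma continuous_projection:
  assumes "1 \<le> n" shows "continuous_map T (level n) (\<lambda>x. x n)"
  unfolding inverse_limit_topology_def
  using assms by (intro continuous_map_from_subtopology continuous_map_product_projection) auto

lemma compact_limit: "compact_space T"
proof -
  let ?P = "product_topology level {1..}"
  have coord: "continuous_map ?P (level n) (\<lambda>x. x n)" if "1 \<le> n" for n
    using that by (intro continuous_map_product_projection) auto
  let ?E = "\<lambda>n. {x \<in> topspace ?P. p n (x (n + 1)) = x n}"
  have "closedin ?P (?E n)" if "1 \<le> n" for n
  proof (rule closedin_continuous_maps_eq)
    have "continuous_map (level (n + 1)) (level n) (p n)"
      using bonding[OF that] unfolding system_surjection_def by blast
    from continuous_map_compose[OF coord this]
    show "continuous_map ?P (level n) (\<lambda>x. p n (x (n + 1)))"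
      by (simp add: o_def)
    show "continuous_map ?P (level n) (\<lambda>x. x n)"
      using coord[OF that] .
  qed simp
  then have "closedin ?P (\<Inter>n\<in>{1..}. ?E n)"
    by (intro closedin_INT) auto
  moreover have "(\<Inter>n\<in>{1..}. ?E n) = X"
  proof
    show "(\<Inter>n\<in>{1..}. ?E n) \<subseteq> X"
      unfolding in_limit_iff subset_iff by (auto simp: PiE_iff)
    show "X \<subseteq> (\<Inter>n\<in>{1..}. ?E n)"
      unfolding in_limit_iff subset_iff by (auto simp: PiE_iff)
  qed
  moreover have "compact_space ?P"
    using finite_level by (simp add: compact_space_product_topology compact_space_discrete_topology)
  ultimately have "compactin ?P X"
    using closedin_compact_space by force
  then show ?thesis
    unfolding inverse_limit_topology_def by (rule compact_space_subtopology)
qed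

text \<open>A basic open set of the product restricts only finitely many coordinates, and the coordinate
  at a level determines all lower ones; so one coordinate, at the highest restricted level, is
  enough.\<close>

lemma cylinder_in_open:
  assumes "openin T U" "x \<in> U"
  obtains N where "1 \<le> N" "{y \<in> X. y N = x N} \<subseteq> U"
proof -
  let ?P = "product_topology level {1..}"
  obtain W where W: "openin ?P W" "U = W \<inter> X"
    using assms(1) unfolding inverse_limit_topology_def openin_subtopology by blast
  moreover have "x \<in> W" using W(2) assms(2) by blast
  ultimately obtain C where C: "finite {i \<in> {1..}. C i \<noteq> topspace (level i)}"
    "x \<in> Pi\<^sub>E {1..} C" "Pi\<^sub>E {1..} C \<subseteq> W"
    unfolding openin_product_topology_alt by blast
  obtain N where N: "\<And>i. i \<in> {i \<in> {1..}. C i \<noteq> topspace (level i)} \<Longrightarrow> i \<le> N"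
    using C(1) unfolding finite_nat_set_iff_bounded_le by blast
  have "y \<in> U" if y: "y \<in> X" "y (max 1 N) = x (max 1 N)" for y
  proof -
    have x: "x \<in> X" using W assms(2) by blast
    have "y i \<in> C i" if "1 \<le> i" for i
    proof (cases "C i = I i")
      case True
      then show ?thesis using in_level y that by simp
    next
      case False
      then have "i \<le> max 1 N" using N that by fastforce
      then have "y i = x i"
        using bond_coordinate[OF x that] bond_coordinate[OF y(1) that] y(2) by metis
      then show ?thesis using C(2) that by auto
    qed
    moreover have "y \<in> extensional {1..}"
      using y(1) unfolding in_limit_iff by blast
    ultimately have "y \<in> Pi\<^sub>E {1..} C" by (simp add: PiE_iff)
    then show ?thesis using C(3) W(2) y(1) by blast
  qed
  then have "{y \<in> X. y (max 1 N) = x (max 1 N)} \<subseteq> U" by blast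
  with max.cobounded1 show thesis by (rule that)
qed

text \<open>The cylinder of a fixed point shrinks as the level grows. The largest level occurring in a
  finite subcover by cylinders therefore works for the whole cover, and so does every higher one.\<close>

lemma cylinders_refine_cover:
  assumes open_cover: "\<And>U. U \<in> \<C> \<Longrightarrow> openin T U" and cover: "X \<subseteq> \<Union>\<C>"
  obtains N where "1 \<le> N"
    "\<And>k x. N \<le> k \<Longrightarrow> x \<in> X \<Longrightarrow> \<exists>U\<in>\<C>. {y \<in> X. y k = x k} \<subseteq> U"
proof -
  have "\<exists>N. 1 \<le> N \<and> (\<exists>U\<in>\<C>. {y \<in> X. y N = x N} \<subseteq> U)" if x: "x \<in> X" for x
  proof -
    obtain U where U: "U \<in> \<C>" "x \<in> U" using subsetD[OF cover x] by (rule UnionE)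
    obtain N where "1 \<le> N" "{y \<in> X. y N = x N} \<subseteq> U"
      using cylinder_in_open[OF open_cover[OF U(1)] U(2)] .
    with U(1) show ?thesis by blast
  qed
  then have "\<forall>x\<in>X. \<exists>N. 1 \<le> N \<and> (\<exists>U\<in>\<C>. {y \<in> X. y N = x N} \<subseteq> U)"
    by blast
  from bchoice[OF this] obtain M
    where M: "\<And>x. x \<in> X \<Longrightarrow> 1 \<le> M x \<and> (\<exists>U\<in>\<C>. {y \<in> X. y (M x) = x (M x)} \<subseteq> U)"
    by blast
  define cyl where "cyl x = {y \<in> X. y (M x) = x (M x)}" for x
  have "openin T (cyl x)" if "x \<in> X" for x
  proof -
    have Mx: "1 \<le> M x" using M[OF that] by blast
    have "openin T {y \<in> topspace T. y (M x) \<in> {x (M x)}}"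
      using in_level[OF that Mx]
      by (intro openin_continuous_map_preimage[OF continuous_projection[OF Mx]]) simp
    then show ?thesis unfolding cyl_def topspace_limit by simp
  qed
  moreover have "X \<subseteq> \<Union>(cyl ` X)" unfolding cyl_def by blast
  ultimately obtain F where F: "finite F" "F \<subseteq> cyl ` X" "X \<subseteq> \<Union>F"
    using compactinD[of T X "cyl ` X"] compact_limit
    unfolding compact_space_def topspace_limit by blast
  obtain Z where "finite Z" "Z \<subseteq> X" "F = cyl ` Z"
    using finite_subset_image[OF F(1,2)] by blast
  with F(3) have Z: "finite Z" "Z \<subseteq> X" "X \<subseteq> \<Union>(cyl ` Z)"
    by auto
  define N where "N = Max (insert 1 (M ` Z))"
  have "1 \<le> N" unfolding N_def using Z(1) by simp
  moreover have "\<exists>U\<in>\<C>. {y \<in> X. y k = x k} \<subseteq> U" if k: "N \<le> k" and x: "x \<in> X" for k x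
  proof -
    obtain z where z: "z \<in> Z" "x \<in> cyl z" using Z x by blast
    then have Mz: "1 \<le> M z" "M z \<le> k"
      using M Z k unfolding N_def by auto
    have "{y \<in> X. y k = x k} \<subseteq> cyl z"
    proof clarify
      fix y assume y: "y \<in> X" "y k = x k"
      then have "y (M z) = x (M z)"
        using bond_coordinate[OF x Mz] bond_coordinate[OF y(1) Mz] by metis
      then show "y \<in> cyl z" using z y unfolding cyl_def by simp
    qed
    moreover have "\<exists>U\<in>\<C>. cyl z \<subseteq> U" using M z Z unfolding cyl_def by blast
    ultimately show ?thesis by blast
  qed
  ultimately show thesis using that by blast
qed

text \<open>Starting from the given edge at level \<open>n\<close>, choose successive preimages \<open>g j\<close> at the levels
  \<open>n + j\<close>; pushing \<open>g i\<close> down from level \<open>n + i\<close> to level \<open>i\<close> defines all coordinates, above and below \<open>n\<close>, by one formula.\<close>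

lemma edge_lifts:
  assumes n: "1 \<le> n" and ab: "(a, b) \<in> \<phi> n"
  obtains x y where "(x, y) \<in> f" "x n = a" "y n = b"
proof -
  have preimage: "\<exists>e'. e' \<in> \<phi> (n + Suc j) \<and> map_prod (p (n + j)) (p (n + j)) e' = e"
    if e: "e \<in> \<phi> (n + j)" for e j
  proof -
    have "map_prod (p (n + j)) (p (n + j)) ` \<phi> (n + Suc j) = \<phi> (n + j)"
      using bonding[of "n + j"] n unfolding system_surjection_def by simp
    then have "e \<in> map_prod (p (n + j)) (p (n + j)) ` \<phi> (n + Suc j)"
      using e by simp
    then show ?thesis by (elim imageE) blast
  qed
  have "\<exists>g. \<forall>j. (g j \<in> \<phi> (n + j) \<and> (j = 0 \<longrightarrow> g j = (a, b))) \<and>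
      map_prod (p (n + j)) (p (n + j)) (g (Suc j)) = g j"
  proof (rule dependent_nat_choice)
    show "\<exists>e. e \<in> \<phi> (n + 0) \<and> (0 = (0::nat) \<longrightarrow> e = (a, b))"
      using ab by simp
    fix e j assume "e \<in> \<phi> (n + j) \<and> (j = 0 \<longrightarrow> e = (a, b))"
    then show "\<exists>e'. (e' \<in> \<phi> (n + Suc j) \<and> (Suc j = 0 \<longrightarrow> e' = (a, b))) \<and>
        map_prod (p (n + j)) (p (n + j)) e' = e"
      using preimage by blast
  qed
  then obtain g where g: "\<And>j. g j \<in> \<phi> (n + j)" "g 0 = (a, b)"
    "\<And>j. map_prod (p (n + j)) (p (n + j)) (g (Suc j)) = g j"
    by blast
  define thread where
    "thread h = (\<lambda>i\<in>{1..}. bond p (n + i) i (h (g i)))" for h :: "'a \<times> 'a \<Rightarrow> 'a"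
  have edge: "(thread fst i, thread snd i) \<in> \<phi> i" if "1 \<le> i" for i
  proof -
    have "map_prod (bond p (n + i) i) (bond p (n + i) i) (g i) \<in> \<phi> i"
      using bond_surjection[of i "n + i"] that g(1)[of i] unfolding system_surjection_def by auto
    then show ?thesis unfolding thread_def using that by (cases "g i") auto
  qed
  have step: "p (n + j) (h (g (Suc j))) = h (g j)" if "h = fst \<or> h = snd" for h j
    using that by (auto simp: g(3)[of j, symmetric])
  have "thread h \<in> X" if h: "h = fst \<or> h = snd" for h
  proof -
    have "thread h i \<in> I i" if "1 \<le> i" for i
      using edge[OF that] system_subset[OF system_level[OF that]] h by auto
    moreover have "p i (thread h (i + 1)) = thread h i" if "1 \<le> i" for i
    proof -
      have "p i (bond p (n + Suc i) (Suc i) (h (g (Suc i)))) = bond p (n + Suc i) i (h (g (Suc i)))"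
        using bond_bond[of i "Suc i" "n + Suc i" p] by simp
      also have "\<dots> = bond p (n + i) i (h (g i))"
        using step[OF h] by simp
      finally show ?thesis unfolding thread_def using that by simp
    qed
    ultimately show ?thesis
      unfolding in_limit_iff by (simp add: thread_def)
  qed
  moreover have "thread h n = h (a, b)" if h: "h = fst \<or> h = snd" for h
  proof -
    have "bond p (n + j) n (h (g j)) = h (a, b)" for j
      by (induction j) (use step[OF h] g(2) in auto)
    then show ?thesis unfolding thread_def using n by simp
  qed
  ultimately show thesis
    using edge that[of "thread fst" "thread snd"] unfolding inverse_limit_relation_def by auto
qed

lemma closed_limit_relation: "closedin (prod_topology T T) f"
proof -
  let ?TT = "prod_topology T T"
  have "closedin ?TT {e \<in> topspace ?TT. (fst e n, snd e n) \<in> \<phi> n}" if "1 \<le> n" for n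
  proof (rule closedin_continuous_map_preimage)
    show "continuous_map ?TT (prod_topology (level n) (level n)) (\<lambda>e. (fst e n, snd e n))"
      using continuous_map_compose[OF continuous_map_fst continuous_projection[OF that], of T]
        continuous_map_compose[OF continuous_map_snd continuous_projection[OF that], of T]
      by (simp add: continuous_map_pairedI o_def)
    show "closedin (prod_topology (level n) (level n)) (\<phi> n)"
      using system_level[OF that] unfolding system_def by blast
  qed
  then have "closedin ?TT (\<Inter>n\<in>{1..}. {e \<in> topspace ?TT. (fst e n, snd e n) \<in> \<phi> n})"
    by (intro closedin_INT) auto
  moreover have "(\<Inter>n\<in>{1..}. {e \<in> topspace ?TT. (fst e n, snd e n) \<in> \<phi> n}) = f"
    unfolding inverse_limit_relation_def by (auto simp: topspace_limit)
  ultimately show ?thesis by simp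
qed

text \<open>Meeting every cylinder means being dense. This is applied to the two projections of \<open>f\<close> to \<open>X\<close>,
  which are closed as compact sets in a Hausdorff space and meet every cylinder because edges lift.\<close>

lemma full_if_closed_meets_cylinders:
  assumes "closedin T C" and "\<And>x n. x \<in> X \<Longrightarrow> 1 \<le> n \<Longrightarrow> \<exists>c\<in>C. c n = x n"
  shows "C = X"
proof -
  have CX: "C \<subseteq> X" using closedin_subset[OF assms(1)] topspace_limit by simp
  have "x \<in> C" if x: "x \<in> X" for x
  proof (rule ccontr)
    assume "x \<notin> C"
    then have "openin T (X - C)" "x \<in> X - C"
      using assms(1) x topspace_limit by (auto simp: closedin_def)
    then obtain N where "1 \<le> N" "{y \<in> X. y N = x N} \<subseteq> X - C"
      using cylinder_in_open by blast
    then show False using assms(2)[OF x] CX by fastforce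
  qed
  then show ?thesis using CX by blast
qed

lemma system_limit:
  assumes "metrizable_space T"
  shows "system T f"
proof -
  have "compact_space (prod_topology T T)"
    using compact_limit compact_space_prod_topology by blast
  then have "compactin (prod_topology T T) f"
    using closedin_compact_space closed_limit_relation by blast
  then have closed: "closedin T (h ` f)" if "continuous_map (prod_topology T T) T h" for h
    using compactin_imp_closedin[OF metrizable_imp_Hausdorff_space[OF assms]]
      image_compactin[OF _ that] by blast
  have "fst ` f = X"
  proof (rule full_if_closed_meets_cylinders[OF closed[OF continuous_map_fst]])
    fix x n assume x: "x \<in> X" and n: "1 \<le> (n::nat)"
    have "x n \<in> fst ` \<phi> n"
      using system_level[OF n] in_level[OF x n] unfolding system_def by simp
    then obtain b where "(x n, b) \<in> \<phi> n" by auto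
    from edge_lifts[OF n this] show "\<exists>c\<in>fst ` f. c n = x n"
      by (metis image_eqI fst_conv)
  qed
  moreover have "snd ` f = X"
  proof (rule full_if_closed_meets_cylinders[OF closed[OF continuous_map_snd]])
    fix x n assume x: "x \<in> X" and n: "1 \<le> (n::nat)"
    have "x n \<in> snd ` \<phi> n"
      using system_level[OF n] in_level[OF x n] unfolding system_def by simp
    then obtain b where "(b, x n) \<in> \<phi> n" by auto
    from edge_lifts[OF n this] show "\<exists>c\<in>snd ` f. c n = x n"
      by (metis image_eqI snd_conv)
  qed
  ultimately show ?thesis
    unfolding system_def topspace_limit
    using assms compact_limit closed_limit_relation by blast
qed

lemma projection_surjection:
  assumes "metrizable_space T" and n: "1 \<le> n"
  shows "system_surjection T f (level n) (\<phi> n) (\<lambda>x. x n)"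
proof -
  let ?\<pi> = "\<lambda>x. x n"
  have rel: "map_prod ?\<pi> ?\<pi> ` f = \<phi> n"
  proof
    show "map_prod ?\<pi> ?\<pi> ` f \<subseteq> \<phi> n"
      unfolding inverse_limit_relation_def using n by auto
    show "\<phi> n \<subseteq> map_prod ?\<pi> ?\<pi> ` f"
    proof clarify
      fix a b assume "(a, b) \<in> \<phi> n"
      then obtain x y where "(x, y) \<in> f" "x n = a" "y n = b" using edge_lifts[OF n] by blast
      then show "(a, b) \<in> map_prod ?\<pi> ?\<pi> ` f" by force
    qed
  qed
  have "?\<pi> ` X = I n"
  proof -
    have "?\<pi> ` (fst ` f) = fst ` (map_prod ?\<pi> ?\<pi> ` f)" by (force simp: image_iff)
    then show ?thesis
      using rel system_limit[OF assms(1)] system_level[OF n]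
      unfolding system_def topspace_limit by simp
  qed
  then show ?thesis
    unfolding system_surjection_def topspace_limit
    using assms system_limit system_level continuous_projection rel topspace_limit by simp
qed

section \<open>Factoring versus lifting\<close>

lemma mesh_projection_small:
  assumes d: "compatible_metric T d" and "0 < (\<epsilon>::real)"
  obtains N where "1 \<le> N" "\<And>k x y. N \<le> k \<Longrightarrow> x \<in> X \<Longrightarrow> y \<in> X \<Longrightarrow> x k = y k \<Longrightarrow> d x y < \<epsilon>"
proof -
  interpret Metric_space X d
    using d unfolding compatible_metric_def topspace_limit by blast
  have top: "mtopology = T"
    using d unfolding compatible_metric_def topspace_limit by blast
  obtain N where N: "1 \<le> N"
    "\<And>k x. N \<le> k \<Longrightarrow> x \<in> X \<Longrightarrow> \<exists>U\<in>(\<lambda>z. mball z (\<epsilon> / 2)) ` X. {y \<in> X. y k = x k} \<subseteq> U"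
  proof (rule cylinders_refine_cover)
    show "openin T U" if "U \<in> (\<lambda>z. mball z (\<epsilon> / 2)) ` X" for U
      using that openin_mball top by auto
    show "X \<subseteq> \<Union> ((\<lambda>z. mball z (\<epsilon> / 2)) ` X)"
      using assms(2) by auto
  qed blast
  have "d x y < \<epsilon>" if "N \<le> k" and xy: "x \<in> X" "y \<in> X" "x k = y k" for k x y
  proof -
    obtain z where z: "z \<in> X" "{y \<in> X. y k = x k} \<subseteq> mball z (\<epsilon> / 2)"
      using N(2)[OF \<open>N \<le> k\<close> xy(1)] by auto
    then have "x \<in> mball z (\<epsilon> / 2)" "y \<in> mball z (\<epsilon> / 2)"
      using xy by auto
    then show ?thesis
      using triangle[of x z y] commute[of x z] xy z by (auto simp: in_mball)
  qed
  then show thesis using N(1) that by blast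
qed

text \<open>The supremum in \<^const>\<open>mesh\<close> bounds distances within fibres only because \<open>d\<close> is bounded on
  the compact space \<open>X\<close>.\<close>

lemma dist_le_mesh:
  assumes d: "compatible_metric T d" and "x \<in> X" "y \<in> X" "\<beta> x = \<beta> y"
  shows "d x y \<le> mesh X d \<beta>"
proof -
  interpret Metric_space X d
    using d unfolding compatible_metric_def topspace_limit by blast
  have top: "mtopology = T"
    using d unfolding compatible_metric_def topspace_limit by blast
  have "compactin mtopology X"
    using compact_limit unfolding top compact_space_def topspace_limit .
  then obtain B where "\<forall>x\<in>X. \<forall>y\<in>X. d x y \<le> B"
    using compactin_imp_mbounded mbounded_alt by blast
  then have "bdd_above {d x y | x y. x \<in> X \<and> y \<in> X \<and> \<beta> x = \<beta> y}"
    by (intro bdd_aboveI[of _ B]) auto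
  then show ?thesis
    unfolding mesh_def using assms by (intro cSup_upper) auto
qed

text \<open>The scale is a Lebesgue number of the cover of \<open>X\<close> by the fibres of \<open>a\<close>.\<close>

lemma locally_constant_scale:
  assumes d: "compatible_metric T d" and a: "continuous_map T (discrete_topology J) a"
  obtains \<delta> where "0 < \<delta>" "\<And>x y. x \<in> X \<Longrightarrow> y \<in> X \<Longrightarrow> d x y < \<delta> \<Longrightarrow> a x = a y"
proof -
  interpret Metric_space X d
    using d unfolding compatible_metric_def topspace_limit by blast
  have top: "mtopology = T"
    using d unfolding compatible_metric_def topspace_limit by blast
  let ?fibres = "(\<lambda>j. {x \<in> topspace T. a x \<in> {j}}) ` J"
  have "openin mtopology U" if "U \<in> ?fibres" for U
    using that unfolding top by (auto intro!: openin_continuous_map_preimage[OF a, of "{_}", simplified])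
  moreover have "X \<subseteq> \<Union>?fibres"
    using continuous_map_funspace[OF a] topspace_limit by auto
  moreover have "compactin mtopology X"
    using compact_limit unfolding top compact_space_def topspace_limit .
  ultimately obtain \<delta> where \<delta>: "0 < \<delta>" "\<forall>x\<in>X. \<exists>U\<in>?fibres. mball x \<delta> \<subseteq> U"
    using lebesgue_number[of X ?fibres] by blast
  have "a x = a y" if xy: "x \<in> X" "y \<in> X" "d x y < \<delta>" for x y
  proof -
    obtain j where "mball x \<delta> \<subseteq> {x \<in> topspace T. a x \<in> {j}}" using \<delta>(2) xy(1) by blast
    moreover have "x \<in> mball x \<delta>" "y \<in> mball x \<delta>" using xy \<delta>(1) by auto
    ultimately show ?thesis by blast
  qed
  then show thesis using \<delta>(1) that by blast
qed

lemma metrizable_if_compatible: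
  assumes "compatible_metric U d" shows "metrizable_space U"
  using assms unfolding compatible_metric_def metrizable_space_def by metis

text \<open>The mesh of the lift is taken below the scale at which the \<open>k\<close>-th coordinate is constant, so
  that this coordinate factors through the lift.\<close>

lemma lifting_imp_factoring:
  assumes d: "compatible_metric T d" and lift: "lifting_property I \<phi> p d"
  shows "factoring_property I \<phi> p"
  unfolding factoring_property_def
proof (intro allI impI)
  fix n k :: nat and q1
  assume n: "1 \<le> n" and k: "n < k"
    and q1: "system_surjection (level k) (\<phi> k) (level n) (\<phi> n) q1"
  have \<pi>: "system_surjection T f (level k) (\<phi> k) (\<lambda>x. x k)"
    using projection_surjection metrizable_if_compatible[OF d] n k by simp
  obtain \<delta> where \<delta>: "0 < \<delta>" "\<And>x y. x \<in> X \<Longrightarrow> y \<in> X \<Longrightarrow> d x y < \<delta> \<Longrightarrow> x k = y k"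
    using locally_constant_scale[OF d continuous_projection, of k] n k by auto
  obtain j \<beta> where j: "n < j" and \<beta>: "system_surjection T f (level j) (\<phi> j) \<beta>"
    and lifted: "\<And>x. x \<in> X \<Longrightarrow> q1 (x k) = bond p j n (\<beta> x)" and fine: "mesh X d \<beta> < \<delta>"
    using lift n \<delta>(1) system_surjection_compose[OF \<pi> q1]
    unfolding lifting_property_def o_def by metis
  have "x k = y k" if "x \<in> X" "y \<in> X" "\<beta> x = \<beta> y" for x y
    using dist_le_mesh[OF d that] fine \<delta>(2) that by simp
  then obtain r where r: "system_surjection (level j) (\<phi> j) (level k) (\<phi> k) r"
    and rb: "\<And>x. x \<in> X \<Longrightarrow> x k = r (\<beta> x)"
    using system_surjection_factors[OF \<pi> \<beta>] unfolding topspace_limit by blast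
  have r_factors: "q1 (r w) = bond p j n w" if "w \<in> I j" for w
  proof -
    have "\<beta> ` X = I j"
      using \<beta> unfolding system_surjection_def topspace_limit by simp
    then show ?thesis using that rb lifted by (metis imageE)
  qed
  \<comment> \<open>The level \<open>j\<close> supplied by lifting need not exceed \<open>k\<close>, so pass to a level above both.\<close>
  define m where "m = Suc (max j k)"
  have m: "k < m" "j \<le> m" unfolding m_def by auto
  have pm: "system_surjection (level m) (\<phi> m) (level j) (\<phi> j) (bond p m j)"
    using bond_surjection n j m by simp
  have "q1 ((r \<circ> bond p m j) x) = bond p m n x" if "x \<in> I m" for x
  proof -
    have "bond p m j x \<in> I j"
      using pm that unfolding system_surjection_def by auto
    then show ?thesis using r_factors bond_bond[of n j m p x] j m by simp
  qed
  then show "\<exists>m>k. \<exists>q2. system_surjection (level m) (\<phi> m) (level k) (\<phi> k) q2 \<and>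
      (\<forall>x\<in>I m. q1 (q2 x) = bond p m n x)"
    using system_surjection_compose[OF pm r] m(1) by blast
qed

text \<open>Factoring \<open>q2\<close> once more makes \<open>q3\<close> a right inverse of \<open>q2\<close> up to bonding maps. Hence \<open>q2\<close>
  recovers the \<open>k\<close>-th coordinate from \<open>q3\<close> applied to the \<open>l\<close>-th one, and this single identity gives
  both the lifting equation and the bound on the mesh.\<close>

lemma factoring_imp_lifting:
  assumes d: "compatible_metric T d" and factoring: "factoring_property I \<phi> p"
    and nonempty: "X \<noteq> {}"
  shows "lifting_property I \<phi> p d"
  unfolding lifting_property_def
proof (intro allI impI)
  fix \<epsilon> :: real and n :: nat and \<alpha>
  assume \<epsilon>: "0 < \<epsilon>" and n: "1 \<le> n" and \<alpha>: "system_surjection T f (level n) (\<phi> n) \<alpha>"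
  note metrizable = metrizable_if_compatible[OF d]
  obtain \<delta> where \<delta>: "0 < \<delta>" "\<And>x y. x \<in> X \<Longrightarrow> y \<in> X \<Longrightarrow> d x y < \<delta> \<Longrightarrow> \<alpha> x = \<alpha> y"
    using locally_constant_scale[OF d, of "I n" \<alpha>] \<alpha> unfolding system_surjection_def by blast
  \<comment> \<open>With \<open>\<epsilon>\<close> halved, the supremum that defines the mesh stays strictly below \<open>\<epsilon>\<close>.\<close>
  obtain N where "1 \<le> N"
    and N: "\<And>k x y. N \<le> k \<Longrightarrow> x \<in> X \<Longrightarrow> y \<in> X \<Longrightarrow> x k = y k \<Longrightarrow> d x y < min \<delta> (\<epsilon> / 2)"
    using mesh_projection_small[OF d, of "min \<delta> (\<epsilon> / 2)"] \<delta>(1) \<epsilon> by auto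
  define k where "k = Suc (max N n)"
  have k: "N \<le> k" "n < k" "1 \<le> k" unfolding k_def by auto
  have fine: "d x y < \<delta>" "d x y < \<epsilon> / 2" if "x \<in> X" "y \<in> X" "x k = y k" for x y
    using N[OF k(1) that] by auto
  obtain q where q: "system_surjection (level k) (\<phi> k) (level n) (\<phi> n) q"
    and \<alpha>q: "\<And>x. x \<in> X \<Longrightarrow> \<alpha> x = q (x k)"
    using system_surjection_factors[OF \<alpha> projection_surjection[OF metrizable k(3)]] fine(1) \<delta>(2)
    unfolding topspace_limit by blast
  obtain m q2 where m: "k < m" and q2: "system_surjection (level m) (\<phi> m) (level k) (\<phi> k) q2"
    and qq2: "\<And>x. x \<in> I m \<Longrightarrow> q (q2 x) = bond p m n x"
    using factoring n k(2) q unfolding factoring_property_def by blast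
  obtain l q3 where l: "m < l" and q3: "system_surjection (level l) (\<phi> l) (level m) (\<phi> m) q3"
    and q2q3: "\<And>x. x \<in> I l \<Longrightarrow> q2 (q3 x) = bond p l k x"
    using factoring k(3) m q2 unfolding factoring_property_def by blast
  let ?\<beta> = "q3 \<circ> (\<lambda>x. x l)"
  have l1: "1 \<le> l" using k m l by simp
  have \<beta>: "system_surjection T f (level m) (\<phi> m) ?\<beta>"
    using system_surjection_compose[OF projection_surjection[OF metrizable l1] q3] .
  have q2\<beta>: "q2 (?\<beta> x) = x k" if "x \<in> X" for x
    using q2q3 in_level[OF that l1] bond_coordinate[OF that k(3), of l] m l by simp
  have "\<alpha> x = bond p m n (?\<beta> x)" if x: "x \<in> X" for x
  proof -
    have "?\<beta> x \<in> I m"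
      using \<beta> x unfolding system_surjection_def topspace_limit by auto
    then have "bond p m n (?\<beta> x) = q (q2 (?\<beta> x))" using qq2 by simp
    then show ?thesis using q2\<beta>[OF x] \<alpha>q[OF x] by simp
  qed
  moreover have "mesh X d ?\<beta> < \<epsilon>"
  proof -
    have "d x y \<le> \<epsilon> / 2" if "x \<in> X" "y \<in> X" "?\<beta> x = ?\<beta> y" for x y
    proof -
      have "x k = y k"
        using q2\<beta>[OF that(1)] q2\<beta>[OF that(2)] that(3) by simp
      then show ?thesis using fine(2)[OF that(1,2)] by simp
    qed
    then have "mesh X d ?\<beta> \<le> \<epsilon> / 2"
      unfolding mesh_def using nonempty by (intro cSup_least) auto
    then show ?thesis using \<epsilon> by simp
  qed
  ultimately show "\<exists>m>n. \<exists>\<beta>. system_surjection T f (level m) (\<phi> m) \<beta> \<and>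
      (\<forall>x\<in>X. \<alpha> x = bond p m n (\<beta> x)) \<and> mesh X d \<beta> < \<epsilon>"
    using \<beta> less_trans[OF k(2) m] by blast
qed

end

theorem theorem3p21:
  fixes I :: "nat \<Rightarrow> nat list set"
    and \<phi> :: "nat \<Rightarrow> (nat list \<times> nat list) set"
    and p :: "nat \<Rightarrow> nat list \<Rightarrow> nat list"
    and d :: "(nat \<Rightarrow> nat list) \<Rightarrow> (nat \<Rightarrow> nat list) \<Rightarrow> real"
  assumes "pointed_shimomura_sequence I \<phi> p"
    and "compatible_metric (inverse_limit_topology I p) d"
  shows "factoring_property I \<phi> p \<longleftrightarrow> lifting_property I \<phi> p d"
proof -
  have seq: "shimomura_sequence I \<phi> p"
    using assms(1) unfolding pointed_shimomura_sequence_def by blast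
  interpret finite_system_sequence I \<phi> p
    using seq unfolding shimomura_sequence_def finite_index_sets_def
    by unfold_locales auto
  have "I 1 \<noteq> {}"
    using seq unfolding shimomura_sequence_def finite_index_sets_def by auto
  moreover have "(\<lambda>x. x 1) ` X = I 1"
    using projection_surjection[OF metrizable_if_compatible[OF assms(2)], of 1]
    unfolding system_surjection_def topspace_limit by simp
  ultimately have "X \<noteq> {}" by blast
  then show ?thesis
    using lifting_imp_factoring factoring_imp_lifting assms(2) by blast
qed

end
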